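(* Let $F$ be a Banach lattice and let $K$ be a compact Hausdorff space. Every order bounded operator $T\colon C(K) \longrightarrow F$ is positively limited, hence $T^{*} \colon F^* \longrightarrow C(K)^*$ is almost Dunford-Pettis.
   Context: Operators are linear. $C(K)$ is the Banach lattice of continuous real functions on $K$ with the sup norm and pointwise order. An operator between Banach lattices is order bounded if it maps order bounded sets to order bounded sets. An operator $T$ from a Banach space $X$ to a Banach lattice $F$ is positively limited if $T^*$ takes positive weak$^*$-null sequences in $F^*$ to norm null sequences in $X^*$. An operator from a Banach lattice to a Banach space is almost Dunford-Pettis if it sends disjoint weakly null sequences to norm null sequences (equivalently, positive disjoint weakly null sequences to norm null sequences). *)

theory Defs
  imports "HOL-Analysis.Analysis" "HOL-Library.Lattice_Algebras"
begin

section \<open>Banach lattices\<close>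

class banach_lattice = banach + ordered_real_vector + lattice_ab_group_add_abs +
  assumes norm_mono_abs: "\<bar>x\<bar> \<le> \<bar>y\<bar> \<Longrightarrow> norm x \<le> norm y"

instance real :: banach_lattice
  by standard (auto simp: sup_max)

lemma norm_abs_bl [simp]: "norm \<bar>x\<bar> = norm (x :: 'a :: banach_lattice)"
  by (intro order.antisym norm_mono_abs) simp_all

lemma pprt_le_abs: "pprt (x :: 'a :: lattice_ab_group_add_abs) \<le> \<bar>x\<bar>"
  by (simp add: pprt_def abs_ge_self)

lemma norm_mono_nonneg:
  fixes x y :: "'a :: banach_lattice"
  assumes "0 \<le> x" "x \<le> y"
  shows "norm x \<le> norm y"
  using assms by (intro norm_mono_abs) (simp add: abs_of_nonneg)

lemma norm_pprt_le: "norm (pprt x) \<le> norm (x :: 'a :: banach_lattice)"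
  using norm_mono_nonneg[OF zero_le_pprt pprt_le_abs, of x] by simp

lemma pprt_diff_eq: "pprt x - pprt (- x) = (x :: 'a :: lattice_ab_group_add)"
  using prts[of x] by (simp add: pprt_neg)

lemma pprt_add_le: "pprt (x + y) \<le> pprt x + pprt (y :: 'a :: lattice_ab_group_add)"
  unfolding pprt_def by (rule sup_least) (simp_all add: add_mono add_nonneg_nonneg)

lemma abs_pprt_diff_le: "\<bar>pprt x - pprt y\<bar> \<le> \<bar>x - (y :: 'a :: lattice_ab_group_add_abs)\<bar>"
proof -
  have *: "pprt x - pprt y \<le> \<bar>x - y\<bar>" for x y :: 'a
    using order.trans[OF pprt_add_le[of "x - y" y] add_right_mono[OF pprt_le_abs]]
    by (simp add: diff_le_eq)
  show ?thesis
    using *[of x y] *[of y x] by (intro abs_leI) (simp_all add: abs_minus_commute)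
qed

lemma sup_eq_pprt: "sup x y = pprt (x - y) + (y :: 'a :: lattice_ab_group_add)"
  by (simp add: pprt_def add_sup_distrib_right)

lemma continuous_on_pprt_bl:
  fixes f :: "'b :: topological_space \<Rightarrow> 'a :: banach_lattice"
  assumes "continuous_on S f"
  shows "continuous_on S (\<lambda>x. pprt (f x))"
proof -
  have "1-lipschitz_on UNIV (pprt :: 'a \<Rightarrow> 'a)"
    by (rule lipschitz_onI) (auto simp: dist_norm intro!: norm_mono_abs abs_pprt_diff_le)
  then have "continuous_on UNIV (pprt :: 'a \<Rightarrow> 'a)"
    by (rule lipschitz_on_continuous_on)
  from continuous_on_compose2[OF this assms] show ?thesis
    by simp
qed


section \<open>The Banach lattice of bounded continuous functions\<close>

text \<open>For compact \<open>K\<close> every continuous function on \<open>K\<close> is bounded, so \<open>K \<Rightarrow>\<^sub>C real\<close> is $C(K)$.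
  The library proves completeness of \<open>'a \<Rightarrow>\<^sub>C 'b\<close> only for metric domains; the arity below
  subsumes that instance.\<close>

instance bcontfun :: (topological_space, complete_space) complete_space
proof
  fix X :: "nat \<Rightarrow> 'a \<Rightarrow>\<^sub>C 'b"
  assume C: "Cauchy X"
  have "uniformly_Cauchy_on UNIV (\<lambda>n. apply_bcontfun (X n))"
    unfolding uniformly_Cauchy_on_def
    by (meson C Cauchy_def dist_bounded le_less_trans)
  then have "uniformly_convergent_on UNIV (\<lambda>n. apply_bcontfun (X n))"
    by (rule Cauchy_uniformly_convergent)
  then obtain l where "uniform_limit UNIV (\<lambda>n. apply_bcontfun (X n)) l sequentially"
    by (auto simp: uniformly_convergent_on_def)
  then show "convergent X"
    using uniform_limit_bcontfunE[OF _ sequentially_bot] convergentI by metis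
qed

instance bcontfun :: (topological_space, banach) banach ..

lemma sup_bcontfun_mem:
  fixes f g :: "'a :: topological_space \<Rightarrow>\<^sub>C 'b :: banach_lattice"
  shows "(\<lambda>x. sup (f x) (g x)) \<in> bcontfun"
proof (rule bcontfun_normI)
  show "continuous_on UNIV (\<lambda>x. sup (f x) (g x))"
    unfolding sup_eq_pprt by (intro continuous_intros continuous_on_pprt_bl) auto
next
  fix x
  have "norm (sup (f x) (g x)) \<le> norm (f x - g x) + norm (g x)"
    unfolding sup_eq_pprt using norm_triangle_ineq norm_pprt_le by (metis add_right_mono order.trans)
  also have "\<dots> \<le> norm (f - g) + norm g"
    using norm_bounded[of "f - g" x] norm_bounded[of g x] by (simp add: add_mono)
  finally show "norm (sup (f x) (g x)) \<le> norm (f - g) + norm g" .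
qed

instantiation bcontfun :: (topological_space, banach_lattice) banach_lattice
begin

definition less_eq_bcontfun :: "'a \<Rightarrow>\<^sub>C 'b \<Rightarrow> 'a \<Rightarrow>\<^sub>C 'b \<Rightarrow> bool"
  where "f \<le> g \<longleftrightarrow> (\<forall>x. apply_bcontfun f x \<le> apply_bcontfun g x)"

definition less_bcontfun :: "'a \<Rightarrow>\<^sub>C 'b \<Rightarrow> 'a \<Rightarrow>\<^sub>C 'b \<Rightarrow> bool"
  where "f < g \<longleftrightarrow> f \<le> g \<and> \<not> g \<le> (f :: 'a \<Rightarrow>\<^sub>C 'b)"

definition sup_bcontfun :: "'a \<Rightarrow>\<^sub>C 'b \<Rightarrow> 'a \<Rightarrow>\<^sub>C 'b \<Rightarrow> 'a \<Rightarrow>\<^sub>C 'b"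
  where "sup f g = Bcontfun (\<lambda>x. sup (apply_bcontfun f x) (apply_bcontfun g x))"

definition inf_bcontfun :: "'a \<Rightarrow>\<^sub>C 'b \<Rightarrow> 'a \<Rightarrow>\<^sub>C 'b \<Rightarrow> 'a \<Rightarrow>\<^sub>C 'b"
  where "inf f g = - sup (- f) (- g :: 'a \<Rightarrow>\<^sub>C 'b)"

definition abs_bcontfun :: "'a \<Rightarrow>\<^sub>C 'b \<Rightarrow> 'a \<Rightarrow>\<^sub>C 'b"
  where "\<bar>f\<bar> = sup f (- f :: 'a \<Rightarrow>\<^sub>C 'b)"

lemma apply_sup_bcontfun:
  fixes f g :: "'a \<Rightarrow>\<^sub>C 'b"
  shows "apply_bcontfun (sup f g) x = sup (apply_bcontfun f x) (apply_bcontfun g x)"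
  unfolding sup_bcontfun_def by (subst Bcontfun_inverse) (simp_all add: sup_bcontfun_mem)

lemma apply_abs_bcontfun:
  fixes f :: "'a \<Rightarrow>\<^sub>C 'b"
  shows "apply_bcontfun \<bar>f\<bar> x = \<bar>apply_bcontfun f x\<bar>"
  by (simp add: abs_bcontfun_def apply_sup_bcontfun abs_lattice)

instance
proof
  fix f g h :: "'a \<Rightarrow>\<^sub>C 'b" and a b :: real
  show "(f < g) = (f \<le> g \<and> \<not> g \<le> f)"
    by (rule less_bcontfun_def)
  show "f \<le> f" "f \<le> g \<Longrightarrow> g \<le> h \<Longrightarrow> f \<le> h"
    by (auto simp: less_eq_bcontfun_def intro: order.trans)
  show "f \<le> g \<Longrightarrow> g \<le> f \<Longrightarrow> f = g"
    by (auto simp: less_eq_bcontfun_def intro!: bcontfun_eqI order.antisym)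
  show "f \<le> g \<Longrightarrow> h + f \<le> h + g"
    by (simp add: less_eq_bcontfun_def)
  show "f \<le> g \<Longrightarrow> 0 \<le> a \<Longrightarrow> a *\<^sub>R f \<le> a *\<^sub>R g"
    by (simp add: less_eq_bcontfun_def scaleR_left_mono)
  show "a \<le> b \<Longrightarrow> 0 \<le> f \<Longrightarrow> a *\<^sub>R f \<le> b *\<^sub>R f"
    by (simp add: less_eq_bcontfun_def scaleR_right_mono)
  show "inf f g \<le> f" "inf f g \<le> g" "f \<le> g \<Longrightarrow> f \<le> h \<Longrightarrow> f \<le> inf g h"
    by (auto simp: less_eq_bcontfun_def inf_bcontfun_def apply_sup_bcontfun)
  show "f \<le> sup f g" "g \<le> sup f g" "g \<le> f \<Longrightarrow> h \<le> f \<Longrightarrow> sup g h \<le> f"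
    by (auto simp: less_eq_bcontfun_def apply_sup_bcontfun)
  show "\<bar>f\<bar> = sup f (- f)"
    by (rule abs_bcontfun_def)
  assume le: "\<bar>f\<bar> \<le> \<bar>g\<bar>"
  show "norm f \<le> norm g"
  proof (rule norm_bound)
    fix x
    have "norm (f x) \<le> norm (g x)"
      using le by (intro norm_mono_abs) (simp add: less_eq_bcontfun_def apply_abs_bcontfun)
    also have "\<dots> \<le> norm g"
      by (rule norm_bounded)
    finally show "norm (f x) \<le> norm g" .
  qed
qed

end


section \<open>The dual Banach lattice\<close>

text \<open>The dual of \<open>'a\<close> is \<open>'a \<Rightarrow>\<^sub>L real\<close>, ordered by the cone of positive functionals; its lattice
  operations are given by the Riesz--Kantorovich formula. Since arities cannot mention the type
  \<open>real\<close> itself, the instance is stated for codomains that are totally ordered, conditionally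
  complete Banach lattices (these are at most one-dimensional).\<close>

lemma bdd_above_norm_bounded:
  fixes S :: "'a :: {banach_lattice, conditionally_complete_linorder} set"
  assumes "\<And>a. a \<in> S \<Longrightarrow> norm a \<le> c"
  shows "bdd_above S"
proof (cases "\<exists>e :: 'a. e \<noteq> 0")
  case True
  then obtain e :: 'a where "e \<noteq> 0" by blast
  define u where "u = ((\<bar>c\<bar> + 1) / norm e) *\<^sub>R \<bar>e\<bar>"
  have u: "norm u = \<bar>c\<bar> + 1" "0 \<le> u"
    using \<open>e \<noteq> 0\<close> by (auto simp: u_def intro!: scaleR_nonneg_nonneg)
  show ?thesis
  proof (rule bdd_aboveI)
    fix a assume "a \<in> S"
    show "a \<le> u"
    proof (rule ccontr)
      assume "\<not> a \<le> u"
      then have "norm u \<le> norm a"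
        using u by (intro norm_mono_nonneg) auto
      with u assms[OF \<open>a \<in> S\<close>] show False by linarith
    qed
  qed
next
  case False
  then show ?thesis
    by (metis bdd_aboveI order.refl)
qed

lemma norm_cSup_le:
  fixes S :: "'a :: {banach_lattice, conditionally_complete_linorder} set"
  assumes "S \<noteq> {}" and bd: "\<And>a. a \<in> S \<Longrightarrow> norm a \<le> c"
  shows "norm (Sup S) \<le> c"
proof (rule ccontr)
  assume gt: "\<not> norm (Sup S) \<le> c"
  have bdd: "bdd_above S"
    using bd by (rule bdd_above_norm_bounded)
  obtain a where a: "a \<in> S" using assms(1) by blast
  have c: "0 \<le> c" using bd[OF a] norm_ge_zero order.trans by blast
  show False
  proof (cases "Sup S \<le> 0")
    case True
    have "a \<le> Sup S" using a bdd by (rule cSup_upper)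
    then have "norm (- Sup S) \<le> norm (- a)"
      using True by (intro norm_mono_nonneg) auto
    with gt bd[OF a] show False by simp
  next
    case False
    define s where "s = Sup S"
    define t where "t = (c / norm s + 1) / 2"
    have s: "0 < s" "c < norm s" using False gt by (auto simp: s_def)
    have "t * norm s = (c + norm s) / 2"
      using s by (simp add: t_def field_simps)
    then have t: "0 \<le> t" "t < 1" "c < t * norm s"
      using s c by (auto simp: t_def)
    have "t *\<^sub>R s < s"
    proof -
      have "0 < (1 - t) *\<^sub>R s"
        using t s by (simp add: order.strict_iff_order scaleR_nonneg_nonneg)
      then show ?thesis by (simp add: algebra_simps)
    qed
    then obtain b where b: "b \<in> S" "t *\<^sub>R s < b"
      using less_cSup_iff[OF assms(1) bdd] by (auto simp: s_def)
    have "norm (t *\<^sub>R s) \<le> norm b"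
      using b t s by (intro norm_mono_nonneg) (auto intro!: scaleR_nonneg_nonneg)
    with t bd[OF b(1)] show False by simp
  qed
qed

definition riesz_kantorovich ::
    "('a :: banach_lattice \<Rightarrow>\<^sub>L 'b :: {banach_lattice, conditionally_complete_linorder}) \<Rightarrow> ('a \<Rightarrow>\<^sub>L 'b) \<Rightarrow> 'a \<Rightarrow> 'b"
  where "riesz_kantorovich \<phi> \<psi> x = (SUP y\<in>{0..x}. \<phi> y + \<psi> (x - y))"

context
  fixes \<phi> \<psi> :: "'a :: banach_lattice \<Rightarrow>\<^sub>L 'b :: {banach_lattice, conditionally_complete_linorder}"
begin

lemma rk_term_bound:
  assumes "y \<in> {0..x}"
  shows "norm (\<phi> y + \<psi> (x - y)) \<le> (norm \<phi> + norm \<psi>) * norm x"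
proof -
  have "norm y \<le> norm x" "norm (x - y) \<le> norm x"
    using assms by (auto intro!: norm_mono_nonneg)
  then have "norm (\<phi> y) \<le> norm \<phi> * norm x" "norm (\<psi> (x - y)) \<le> norm \<psi> * norm x"
    by (meson mult_left_mono norm_blinfun norm_ge_zero order.trans)+
  then show ?thesis
    using norm_triangle_ineq[of "\<phi> y" "\<psi> (x - y)"] by (simp add: algebra_simps)
qed

lemma rk_bdd: "bdd_above ((\<lambda>y. \<phi> y + \<psi> (x - y)) ` {0..x})"
  by (rule bdd_above_norm_bounded[where c = "(norm \<phi> + norm \<psi>) * norm x"])
    (use rk_term_bound in blast)

lemma rk_upper: "0 \<le> y \<Longrightarrow> y \<le> x \<Longrightarrow> \<phi> y + \<psi> (x - y) \<le> riesz_kantorovich \<phi> \<psi> x"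
  unfolding riesz_kantorovich_def by (rule cSUP_upper[OF _ rk_bdd]) simp

lemma rk_least:
  "0 \<le> x \<Longrightarrow> (\<And>y. 0 \<le> y \<Longrightarrow> y \<le> x \<Longrightarrow> \<phi> y + \<psi> (x - y) \<le> z) \<Longrightarrow> riesz_kantorovich \<phi> \<psi> x \<le> z"
  unfolding riesz_kantorovich_def by (rule cSUP_least) auto

lemma norm_rk_le:
  assumes "0 \<le> x"
  shows "norm (riesz_kantorovich \<phi> \<psi> x) \<le> (norm \<phi> + norm \<psi>) * norm x"
  unfolding riesz_kantorovich_def
  by (rule norm_cSup_le) (use assms rk_term_bound in auto)

lemma rk_add:
  assumes "0 \<le> x" "0 \<le> y"
  shows "riesz_kantorovich \<phi> \<psi> (x + y) = riesz_kantorovich \<phi> \<psi> x + riesz_kantorovich \<phi> \<psi> y"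
    (is "?R (x + y) = _")
proof (rule order.antisym)
  show "?R (x + y) \<le> ?R x + ?R y"
  proof (rule rk_least)
    fix z assume z: "0 \<le> z" "z \<le> x + y"
    define w where "w = inf z x"
    have w: "0 \<le> w" "w \<le> x" "0 \<le> z - w" using z assms by (auto simp: w_def simp del: diff_inf_eq_sup)
    have "z - w = sup 0 (z - x)"
      by (simp add: w_def add_sup_distrib_left)
    also have "\<dots> \<le> y" using z assms by (simp add: diff_le_eq add.commute)
    finally have "z - w \<le> y" .
    with w have "\<phi> w + \<psi> (x - w) + (\<phi> (z - w) + \<psi> (y - (z - w))) \<le> ?R x + ?R y"
      by (intro add_mono rk_upper)
    also have "\<phi> w + \<psi> (x - w) + (\<phi> (z - w) + \<psi> (y - (z - w))) = \<phi> z + \<psi> (x + y - z)"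
      by (simp add: blinfun.bilinear_simps)
    finally show "\<phi> z + \<psi> (x + y - z) \<le> ?R x + ?R y" .
  qed (use assms in simp)
  have 1: "\<phi> v + \<psi> (x - v) + (\<phi> w + \<psi> (y - w)) \<le> ?R (x + y)"
    if "0 \<le> v" "v \<le> x" "0 \<le> w" "w \<le> y" for v w
  proof -
    have "\<phi> (v + w) + \<psi> (x + y - (v + w)) \<le> ?R (x + y)"
      using that by (intro rk_upper add_nonneg_nonneg add_mono)
    then show ?thesis by (simp add: blinfun.bilinear_simps algebra_simps)
  qed
  have "?R y \<le> ?R (x + y) - (\<phi> v + \<psi> (x - v))" if "0 \<le> v" "v \<le> x" for v
    using assms 1[OF that] by (intro rk_least) (auto simp: le_diff_eq add.commute)
  then have "\<phi> v + \<psi> (x - v) \<le> ?R (x + y) - ?R y" if "0 \<le> v" "v \<le> x" for v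
    using that by (simp add: le_diff_eq add.commute)
  then have "?R x \<le> ?R (x + y) - ?R y"
    using assms by (intro rk_least)
  then show "?R x + ?R y \<le> ?R (x + y)"
    by (simp add: le_diff_eq)
qed

lemma rk_scaleR:
  assumes "0 \<le> x" "0 \<le> c"
  shows "riesz_kantorovich \<phi> \<psi> (c *\<^sub>R x) = c *\<^sub>R riesz_kantorovich \<phi> \<psi> x" (is "_ = _ *\<^sub>R ?R x")
proof -
  have le: "d *\<^sub>R ?R z \<le> ?R (d *\<^sub>R z)" if d: "0 < d" and z: "0 \<le> z" for d :: real and z :: 'a
  proof -
    have "\<phi> y + \<psi> (z - y) \<le> inverse d *\<^sub>R ?R (d *\<^sub>R z)" if y: "0 \<le> y" "y \<le> z" for y :: 'a
    proof -
      have "\<phi> (d *\<^sub>R y) + \<psi> (d *\<^sub>R z - d *\<^sub>R y) \<le> ?R (d *\<^sub>R z)"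
        using d y by (intro rk_upper scaleR_left_mono scaleR_nonneg_nonneg) auto
      then have "d *\<^sub>R (\<phi> y + \<psi> (z - y)) \<le> ?R (d *\<^sub>R z)"
        by (simp add: blinfun.bilinear_simps algebra_simps)
      from scaleR_left_mono[OF this, of "inverse d"] show ?thesis
        using d by simp
    qed
    then have "?R z \<le> inverse d *\<^sub>R ?R (d *\<^sub>R z)"
      using z by (intro rk_least)
    from scaleR_left_mono[OF this, of d] show ?thesis
      using d by simp
  qed
  show ?thesis
  proof (cases "c = 0")
    case True
    then show ?thesis by (simp add: riesz_kantorovich_def)
  next
    case False
    then have c: "0 < c" using assms by simp
    show ?thesis
    proof (rule order.antisym)
      have "inverse c *\<^sub>R ?R (c *\<^sub>R x) \<le> ?R x"
        using le[of "inverse c" "c *\<^sub>R x"] c assms by (simp add: scaleR_nonneg_nonneg)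
      from scaleR_left_mono[OF this, of c] show "?R (c *\<^sub>R x) \<le> c *\<^sub>R ?R x"
        using c by simp
    qed (rule le[OF c assms(1)])
  qed
qed

lemma rk_diff:
  assumes "0 \<le> a" "0 \<le> b"
  shows "riesz_kantorovich \<phi> \<psi> (pprt (a - b)) - riesz_kantorovich \<phi> \<psi> (pprt (b - a)) =
    riesz_kantorovich \<phi> \<psi> a - riesz_kantorovich \<phi> \<psi> b"
proof -
  have "pprt (a - b) + b = pprt (b - a) + a"
    using pprt_diff_eq[of "a - b"] by (simp add: algebra_simps)
  then have "riesz_kantorovich \<phi> \<psi> (pprt (a - b) + b) = riesz_kantorovich \<phi> \<psi> (pprt (b - a) + a)"
    by simp
  then show ?thesis
    using assms by (simp add: rk_add algebra_simps)
qed

lemma bounded_linear_rk: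
  "bounded_linear (\<lambda>x. riesz_kantorovich \<phi> \<psi> (pprt x) - riesz_kantorovich \<phi> \<psi> (pprt (- x)))"
    (is "bounded_linear ?L")
proof (rule bounded_linear_intro)
  let ?R = "riesz_kantorovich \<phi> \<psi>"
  have L: "?L z = ?R a - ?R b" if "z = a - b" "0 \<le> a" "0 \<le> b" for z a b
    using rk_diff[OF that(2,3)] that(1) by simp
  fix x y :: 'a and c :: real
  have "?L (x + y) = ?R (pprt x + pprt y) - ?R (pprt (- x) + pprt (- y))"
    using pprt_diff_eq[of x] pprt_diff_eq[of y]
    by (intro L add_nonneg_nonneg zero_le_pprt) (simp add: algebra_simps)
  then show "?L (x + y) = ?L x + ?L y"
    by (simp add: rk_add)
  show "?L (c *\<^sub>R x) = c *\<^sub>R ?L x"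
  proof (cases "0 \<le> c")
    case True
    then have "?L (c *\<^sub>R x) = ?R (c *\<^sub>R pprt x) - ?R (c *\<^sub>R pprt (- x))"
      by (intro L scaleR_nonneg_nonneg zero_le_pprt)
        (simp_all add: pprt_diff_eq flip: scaleR_diff_right)
    with True show ?thesis
      by (simp add: rk_scaleR scaleR_diff_right)
  next
    case False
    then have "?L (c *\<^sub>R x) = ?R ((- c) *\<^sub>R pprt (- x)) - ?R ((- c) *\<^sub>R pprt x)"
      using pprt_diff_eq[of x]
      by (intro L scaleR_nonneg_nonneg zero_le_pprt)
        (simp_all flip: scaleR_diff_right scaleR_minus_right)
    with False show ?thesis
      using rk_scaleR[of "pprt x" "- c"] rk_scaleR[of "pprt (- x)" "- c"]
      by (simp add: scaleR_diff_right)
  qed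
  have B: "norm (?R (pprt z)) \<le> (norm \<phi> + norm \<psi>) * norm z" for z
    using norm_rk_le[OF zero_le_pprt, of z] norm_pprt_le[of z]
    by (meson add_nonneg_nonneg mult_left_mono norm_ge_zero order.trans)
  have "norm (?L x) \<le> norm (?R (pprt x)) + norm (?R (pprt (- x)))"
    by (rule norm_triangle_ineq4)
  also have "\<dots> \<le> norm x * (2 * (norm \<phi> + norm \<psi>))"
    using B[of x] B[of "- x"] by (simp add: algebra_simps)
  finally show "norm (?L x) \<le> norm x * (2 * (norm \<phi> + norm \<psi>))" .
qed

end

instantiation blinfun ::
  (banach_lattice, "{banach_lattice, conditionally_complete_linorder}") banach_lattice
begin

definition less_eq_blinfun :: "'a \<Rightarrow>\<^sub>L 'b \<Rightarrow> 'a \<Rightarrow>\<^sub>L 'b \<Rightarrow> bool"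
  where "\<phi> \<le> \<psi> \<longleftrightarrow> (\<forall>x\<ge>0. blinfun_apply \<phi> x \<le> blinfun_apply \<psi> x)"

definition less_blinfun :: "'a \<Rightarrow>\<^sub>L 'b \<Rightarrow> 'a \<Rightarrow>\<^sub>L 'b \<Rightarrow> bool"
  where "\<phi> < \<psi> \<longleftrightarrow> \<phi> \<le> \<psi> \<and> \<not> \<psi> \<le> (\<phi> :: 'a \<Rightarrow>\<^sub>L 'b)"

definition sup_blinfun :: "'a \<Rightarrow>\<^sub>L 'b \<Rightarrow> 'a \<Rightarrow>\<^sub>L 'b \<Rightarrow> 'a \<Rightarrow>\<^sub>L 'b"
  where "sup \<phi> \<psi> = Blinfun (\<lambda>x. riesz_kantorovich \<phi> \<psi> (pprt x) - riesz_kantorovich \<phi> \<psi> (pprt (- x)))"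

definition inf_blinfun :: "'a \<Rightarrow>\<^sub>L 'b \<Rightarrow> 'a \<Rightarrow>\<^sub>L 'b \<Rightarrow> 'a \<Rightarrow>\<^sub>L 'b"
  where "inf \<phi> \<psi> = - sup (- \<phi>) (- \<psi> :: 'a \<Rightarrow>\<^sub>L 'b)"

definition abs_blinfun :: "'a \<Rightarrow>\<^sub>L 'b \<Rightarrow> 'a \<Rightarrow>\<^sub>L 'b"
  where "\<bar>\<phi>\<bar> = sup \<phi> (- \<phi> :: 'a \<Rightarrow>\<^sub>L 'b)"

lemma apply_sup_blinfun:
  fixes \<phi> \<psi> :: "'a \<Rightarrow>\<^sub>L 'b"
  assumes "0 \<le> x"
  shows "blinfun_apply (sup \<phi> \<psi>) x = riesz_kantorovich \<phi> \<psi> x"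
  using assms unfolding sup_blinfun_def
  by (subst bounded_linear_Blinfun_apply[OF bounded_linear_rk]) (simp add: riesz_kantorovich_def)

lemma sup_blinfun_upper1: "\<phi> \<le> sup \<phi> (\<psi> :: 'a \<Rightarrow>\<^sub>L 'b)"
  unfolding less_eq_blinfun_def using rk_upper[where y = x and x = x for x, of _ \<phi> \<psi>]
  by (simp add: apply_sup_blinfun)

lemma sup_blinfun_upper2: "\<psi> \<le> sup \<phi> (\<psi> :: 'a \<Rightarrow>\<^sub>L 'b)"
  unfolding less_eq_blinfun_def using rk_upper[where y = 0, of _ \<phi> \<psi>]
  by (simp add: apply_sup_blinfun)

lemma sup_blinfun_least:
  fixes \<phi> \<psi> \<xi> :: "'a \<Rightarrow>\<^sub>L 'b"
  assumes "\<phi> \<le> \<xi>" "\<psi> \<le> \<xi>"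
  shows "sup \<phi> \<psi> \<le> \<xi>"
  unfolding less_eq_blinfun_def
proof (intro allI impI)
  fix x :: 'a assume x: "0 \<le> x"
  show "blinfun_apply (sup \<phi> \<psi>) x \<le> blinfun_apply \<xi> x"
    unfolding apply_sup_blinfun[OF x]
  proof (rule rk_least[OF x])
    fix y assume "0 \<le> y" "y \<le> x"
    then have "\<phi> y + \<psi> (x - y) \<le> \<xi> y + \<xi> (x - y)"
      using assms by (intro add_mono) (auto simp: less_eq_blinfun_def)
    then show "\<phi> y + \<psi> (x - y) \<le> \<xi> x"
      by (simp add: blinfun.bilinear_simps)
  qed
qed

lemma neg_le_blinfun: "- \<phi> \<le> \<psi> \<longleftrightarrow> - \<psi> \<le> (\<phi> :: 'a \<Rightarrow>\<^sub>L 'b)"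
  unfolding less_eq_blinfun_def by (simp add: blinfun.bilinear_simps minus_le_iff)

lemma abs_apply_le_blinfun:
  fixes \<phi> :: "'a \<Rightarrow>\<^sub>L 'b"
  shows "\<bar>blinfun_apply \<phi> x\<bar> \<le> blinfun_apply \<bar>\<phi>\<bar> \<bar>x\<bar>"
proof -
  have *: "\<phi> y \<le> \<bar>\<phi>\<bar> y" "- \<phi> y \<le> \<bar>\<phi>\<bar> y" if "0 \<le> y" for y :: 'a
    using that sup_blinfun_upper1[of \<phi> "- \<phi>"] sup_blinfun_upper2[of "- \<phi>" \<phi>]
    by (auto simp: less_eq_blinfun_def abs_blinfun_def blinfun.bilinear_simps)
  have x: "x = pprt x - pprt (- x)" "\<bar>x\<bar> = pprt x + pprt (- x)"
    by (simp only: pprt_diff_eq) (simp add: abs_prts pprt_neg)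
  have "\<phi> x = \<phi> (pprt x) - \<phi> (pprt (- x))" "\<bar>\<phi>\<bar> \<bar>x\<bar> = \<bar>\<phi>\<bar> (pprt x) + \<bar>\<phi>\<bar> (pprt (- x))"
    by (metis blinfun.diff_right x(1), metis blinfun.add_right x(2))
  then show ?thesis
    using add_mono[OF *(1)[of "pprt x"] *(2)[of "pprt (- x)"]]
      add_mono[OF *(2)[of "pprt x"] *(1)[of "pprt (- x)"]]
    by (intro abs_leI) simp_all
qed

lemma norm_abs_apply_le_blinfun:
  fixes \<phi> :: "'a \<Rightarrow>\<^sub>L 'b"
  shows "norm (blinfun_apply \<bar>\<phi>\<bar> \<bar>x\<bar>) \<le> norm \<phi> * norm x"
proof -
  have "norm (\<phi> y + (- \<phi>) (\<bar>x\<bar> - y)) \<le> norm \<phi> * norm x" if y: "0 \<le> y" "y \<le> \<bar>x\<bar>" for y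
  proof -
    have "y + y \<le> \<bar>x\<bar> + \<bar>x\<bar>" "0 \<le> y + y"
      using y by (auto intro: add_mono)
    then have "\<bar>y + y - \<bar>x\<bar>\<bar> \<le> \<bar>x\<bar>"
      by (intro abs_leI) (simp_all add: diff_le_eq)
    then have n: "norm (y + y - \<bar>x\<bar>) \<le> norm x"
      by (rule norm_mono_abs)
    have "\<phi> y + (- \<phi>) (\<bar>x\<bar> - y) = \<phi> (y + y - \<bar>x\<bar>)"
      by (simp add: blinfun.bilinear_simps)
    then show ?thesis
      using norm_blinfun[of \<phi> "y + y - \<bar>x\<bar>"] mult_left_mono[OF n norm_ge_zero[of \<phi>]] by simp
  qed
  then show ?thesis
    unfolding abs_blinfun_def apply_sup_blinfun[OF abs_ge_zero] riesz_kantorovich_def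
    by (intro norm_cSup_le) auto
qed

instance
proof
  fix \<phi> \<psi> \<xi> :: "'a \<Rightarrow>\<^sub>L 'b" and a b :: real
  show "(\<phi> < \<psi>) = (\<phi> \<le> \<psi> \<and> \<not> \<psi> \<le> \<phi>)"
    by (rule less_blinfun_def)
  show "\<phi> \<le> \<phi>" "\<phi> \<le> \<psi> \<Longrightarrow> \<psi> \<le> \<xi> \<Longrightarrow> \<phi> \<le> \<xi>"
    by (auto simp: less_eq_blinfun_def intro: order.trans)
  show "\<phi> = \<psi>" if "\<phi> \<le> \<psi>" "\<psi> \<le> \<phi>"
  proof (rule blinfun_eqI)
    fix x
    have *: "\<phi> y = \<psi> y" if "0 \<le> y" for y :: 'a
      using that \<open>\<phi> \<le> \<psi>\<close> \<open>\<psi> \<le> \<phi>\<close> by (auto simp: less_eq_blinfun_def intro: order.antisym)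
    show "\<phi> x = \<psi> x"
      using *[of "pprt x"] *[of "pprt (- x)"] pprt_diff_eq[of x]
      by (metis blinfun.diff_right zero_le_pprt)
  qed
  show "\<phi> \<le> \<psi> \<Longrightarrow> \<xi> + \<phi> \<le> \<xi> + \<psi>"
    by (simp add: less_eq_blinfun_def blinfun.bilinear_simps)
  show "\<phi> \<le> \<psi> \<Longrightarrow> 0 \<le> a \<Longrightarrow> a *\<^sub>R \<phi> \<le> a *\<^sub>R \<psi>"
    by (simp add: less_eq_blinfun_def blinfun.bilinear_simps scaleR_left_mono)
  show "a \<le> b \<Longrightarrow> 0 \<le> \<phi> \<Longrightarrow> a *\<^sub>R \<phi> \<le> b *\<^sub>R \<phi>"
    by (simp add: less_eq_blinfun_def blinfun.bilinear_simps scaleR_right_mono)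
  show "\<phi> \<le> sup \<phi> \<psi>" "\<psi> \<le> sup \<phi> \<psi>" "\<psi> \<le> \<phi> \<Longrightarrow> \<xi> \<le> \<phi> \<Longrightarrow> sup \<psi> \<xi> \<le> \<phi>"
    by (rule sup_blinfun_upper1 sup_blinfun_upper2 sup_blinfun_least; assumption)+
  show "inf \<phi> \<psi> \<le> \<phi>" "inf \<phi> \<psi> \<le> \<psi>"
    unfolding inf_blinfun_def
    by (subst neg_le_blinfun, rule sup_blinfun_upper1 sup_blinfun_upper2)+
  show "\<phi> \<le> inf \<psi> \<xi>" if "\<phi> \<le> \<psi>" "\<phi> \<le> \<xi>"
  proof -
    have "sup (- \<psi>) (- \<xi>) \<le> - \<phi>"
      using that by (intro sup_blinfun_least) (auto simp: less_eq_blinfun_def blinfun.bilinear_simps)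
    then show ?thesis
      unfolding inf_blinfun_def using neg_le_blinfun[of "- sup (- \<psi>) (- \<xi>)" "- \<phi>"]
      by simp
  qed
  show "\<bar>\<phi>\<bar> = sup \<phi> (- \<phi>)"
    by (rule abs_blinfun_def)
  assume le: "\<bar>\<phi>\<bar> \<le> \<bar>\<psi>\<bar>"
  show "norm \<phi> \<le> norm \<psi>"
  proof (rule norm_blinfun_bound)
    fix x
    have "\<bar>\<phi> x\<bar> \<le> \<bar>\<psi>\<bar> \<bar>x\<bar>"
      using abs_apply_le_blinfun[of \<phi> x] le
      by (meson abs_ge_zero less_eq_blinfun_def order.trans)
    then have "norm (\<phi> x) \<le> norm (\<bar>\<psi>\<bar> \<bar>x\<bar>)"
      using norm_mono_nonneg[OF abs_ge_zero] by fastforce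
    also have "\<dots> \<le> norm \<psi> * norm x"
      by (rule norm_abs_apply_le_blinfun)
    finally show "norm (\<phi> x) \<le> norm \<psi> * norm x" .
  qed simp
qed

end


section \<open>Classes of operators\<close>

definition order_bounded_set :: "'a :: banach_lattice set \<Rightarrow> bool"
  where "order_bounded_set A \<longleftrightarrow> (\<exists>a b. A \<subseteq> {a..b})"

definition order_bounded :: "('a :: banach_lattice \<Rightarrow> 'b :: banach_lattice) \<Rightarrow> bool"
  where "order_bounded T \<longleftrightarrow> (\<forall>A. order_bounded_set A \<longrightarrow> order_bounded_set (T ` A))"

text \<open>The adjoint; meaningful only for bounded linear \<open>T\<close>.\<close>

definition dual_map ::
    "('a :: real_normed_vector \<Rightarrow> 'b :: real_normed_vector) \<Rightarrow> ('b \<Rightarrow>\<^sub>L real) \<Rightarrow> ('a \<Rightarrow>\<^sub>L real)"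
  where "dual_map T \<phi> = Blinfun (\<lambda>x. blinfun_apply \<phi> (T x))"

definition weakly_null :: "(nat \<Rightarrow> 'a :: real_normed_vector) \<Rightarrow> bool"
  where "weakly_null x \<longleftrightarrow> (\<forall>\<phi> :: 'a \<Rightarrow>\<^sub>L real. (\<lambda>n. blinfun_apply \<phi> (x n)) \<longlonglongrightarrow> 0)"

definition weak_star_null :: "(nat \<Rightarrow> 'a :: real_normed_vector \<Rightarrow>\<^sub>L real) \<Rightarrow> bool"
  where "weak_star_null \<phi> \<longleftrightarrow> (\<forall>x. (\<lambda>n. blinfun_apply (\<phi> n) x) \<longlonglongrightarrow> 0)"

definition disjoint_seq :: "(nat \<Rightarrow> 'a :: banach_lattice) \<Rightarrow> bool"
  where "disjoint_seq x \<longleftrightarrow> (\<forall>m n. m \<noteq> n \<longrightarrow> inf \<bar>x m\<bar> \<bar>x n\<bar> = 0)"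

text \<open>Both notions below include boundedness of the operator; for \<open>positively_limited\<close> this makes
  \<open>dual_map T\<close> the genuine adjoint.\<close>

definition positively_limited :: "('a :: banach \<Rightarrow> 'b :: banach_lattice) \<Rightarrow> bool"
  where "positively_limited T \<longleftrightarrow> bounded_linear T \<and>
    (\<forall>\<phi> :: nat \<Rightarrow> 'b \<Rightarrow>\<^sub>L real. (\<forall>n. 0 \<le> \<phi> n) \<and> weak_star_null \<phi> \<longrightarrow> (\<lambda>n. dual_map T (\<phi> n)) \<longlonglongrightarrow> 0)"

definition almost_Dunford_Pettis :: "('a :: banach_lattice \<Rightarrow> 'b :: banach) \<Rightarrow> bool"
  where "almost_Dunford_Pettis S \<longleftrightarrow> bounded_linear S \<and>
    (\<forall>x. disjoint_seq x \<and> weakly_null x \<longrightarrow> (\<lambda>n. S (x n)) \<longlonglongrightarrow> 0)"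

end

theory Submission
  imports Defs
begin

text \<open>An order bounded operator \<open>T\<close> on \<open>C(K)\<close> sends the unit ball, which is the order interval
  \<open>[- 1, 1]\<close>, into some order interval \<open>[- u, u]\<close>. So \<open>\<bar>T f\<bar> \<le> norm f *\<^sub>R u\<close> for all \<open>f\<close>
  (\<open>order_bounded_imp_dominated\<close>), which makes \<open>T\<close> bounded and gives
  \<open>norm (T\<^sup>* \<phi>) \<le> \<bar>\<phi>\<bar> u\<close> for every functional \<open>\<phi>\<close> (\<open>norm_dual_map_dominated\<close>). Both claims
  thereby reduce to the convergence of the numbers \<open>\<bar>\<phi> n\<bar> u\<close> to \<open>0\<close>.

  For positive weak* null \<open>\<phi>\<close> they tend to \<open>0\<close> by definition. For disjoint, weakly null \<open>\<phi>\<close>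
  of arbitrary sign they do so because evaluation at \<open>u\<close> is a positive functional on the dual, and
  a positive functional \<open>f\<close> tends to \<open>0\<close> along the moduli of any disjoint weakly null sequence \<open>x\<close>
  (\<open>disjoint_weakly_null_abs\<close>). The reason for the last fact is that disjointness makes it possible to cut
  \<open>f\<close> down to a functional \<open>G\<close> which agrees with \<open>f\<close> on every positive part of \<open>x n\<close> and vanishes
  on every negative part; then \<open>G (x n) \<longlonglongrightarrow> 0\<close> says that \<open>f\<close> tends to \<open>0\<close> along the positive
  parts. On the positive cone, \<open>G y\<close> is the limit of \<open>f (inf y (e N))\<close> for an increasing sequence
  \<open>e\<close> that exhausts the ideal generated by the positive parts.\<close>

section \<open>Functionals on the positive cone\<close>

text \<open>Writing \<open>x\<close> as a difference of two positive elements determines the extension; additivity makes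
  it independent of the chosen difference, here the one of the positive and negative parts.\<close>

lemma bounded_linear_from_cone:
  fixes R :: "'a :: banach_lattice \<Rightarrow> real"
  assumes add: "\<And>x y. 0 \<le> x \<Longrightarrow> 0 \<le> y \<Longrightarrow> R (x + y) = R x + R y"
    and scale: "\<And>c x. 0 \<le> c \<Longrightarrow> 0 \<le> x \<Longrightarrow> R (c *\<^sub>R x) = c * R x"
    and bound: "\<And>x. 0 \<le> x \<Longrightarrow> \<bar>R x\<bar> \<le> C * norm x"
    and C: "0 \<le> C"
  obtains G :: "'a \<Rightarrow>\<^sub>L real" where "\<And>x. 0 \<le> x \<Longrightarrow> blinfun_apply G x = R x"
proof -
  define L where "L x = R (pprt x) - R (pprt (- x))" for x
  have L: "L z = R a - R b" if "z = a - b" "0 \<le> a" "0 \<le> b" for z a b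
  proof -
    have "pprt z + b = pprt (- z) + a"
      unfolding that(1) using pprt_diff_eq[of "a - b"] by (simp add: algebra_simps)
    then have "R (pprt z + b) = R (pprt (- z) + a)" by simp
    then show ?thesis using that by (simp add: add L_def)
  qed
  have "bounded_linear L"
  proof (rule bounded_linear_intro)
    fix x y :: 'a and c :: real
    have "L (x + y) = R (pprt x + pprt y) - R (pprt (- x) + pprt (- y))"
      using pprt_diff_eq[of x] pprt_diff_eq[of y]
      by (intro L add_nonneg_nonneg zero_le_pprt) (simp add: algebra_simps)
    then show "L (x + y) = L x + L y"
      by (simp add: add L_def)
    show "L (c *\<^sub>R x) = c *\<^sub>R L x"
    proof (cases "0 \<le> c")
      case True
      then have "L (c *\<^sub>R x) = R (c *\<^sub>R pprt x) - R (c *\<^sub>R pprt (- x))"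
        by (intro L scaleR_nonneg_nonneg zero_le_pprt)
          (simp_all add: pprt_diff_eq flip: scaleR_diff_right)
      with True show ?thesis
        by (simp add: scale L_def right_diff_distrib)
    next
      case False
      then have "L (c *\<^sub>R x) = R ((- c) *\<^sub>R pprt (- x)) - R ((- c) *\<^sub>R pprt x)"
        using pprt_diff_eq[of x]
        by (intro L scaleR_nonneg_nonneg zero_le_pprt)
          (simp_all flip: scaleR_diff_right scaleR_minus_right)
      with False show ?thesis
        using scale[of "- c" "pprt x"] scale[of "- c" "pprt (- x)"]
        by (simp add: L_def right_diff_distrib)
    qed
    have B: "\<bar>R (pprt z)\<bar> \<le> C * norm z" for z
      using bound[OF zero_le_pprt, of z] mult_left_mono[OF norm_pprt_le C, of z] by linarith
    show "norm (L x) \<le> norm x * (2 * C)"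
      using B[of x] B[of "- x"] by (simp add: L_def algebra_simps)
  qed
  then have "blinfun_apply (Blinfun L) = L"
    by (rule bounded_linear_Blinfun_apply)
  moreover have "L x = R x" if "0 \<le> x" for x
    using L[of x x 0] that scale[of 0 0] by simp
  ultimately show ?thesis
    using that[of "Blinfun L"] by simp
qed

section \<open>Cutting a positive functional down to an ideal\<close>

lemma inf_add_le:
  fixes y z e :: "'a :: lattice_ab_group_add"
  assumes "0 \<le> y" "0 \<le> z" "0 \<le> e"
  shows "inf (y + z) e \<le> inf y e + inf z e"
proof -
  let ?w = "inf (y + z) e"
  have "?w - inf y e = sup (?w - y) (?w - e)"
    by (simp only: diff_conv_add_uminus neg_inf_eq_sup add_sup_distrib_left)
  also have "\<dots> \<le> inf z e"
  proof (intro sup_least inf_greatest)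
    show "?w - y \<le> z"
      using inf_le1[of "y + z" e] by (simp add: diff_le_eq add.commute)
    show "?w - e \<le> z"
      using order.trans[OF inf_le2 add_increasing[OF assms(2) order.refl], of "y + z" e]
      by (simp add: diff_le_eq)
    show "?w - y \<le> e" "?w - e \<le> e"
      using assms order.trans[OF inf_le2 add_increasing2[of _ e e], of _ "y + z"]
      by (simp_all add: diff_le_eq)
  qed
  finally show ?thesis
    by (simp only: diff_le_eq add.commute)
qed

lemma inf_sum_eq_0:
  fixes p :: "'i \<Rightarrow> 'a :: lattice_ab_group_add"
  assumes "0 \<le> z" "\<And>i. i \<in> I \<Longrightarrow> 0 \<le> p i" "\<And>i. i \<in> I \<Longrightarrow> inf z (p i) = 0"
  shows "inf z (sum p I) = 0"
  using assms
proof (induction I rule: infinite_finite_induct)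
  case (insert i I)
  have "inf z (p i + sum p I) \<le> inf z (p i) + inf z (sum p I)"
    using inf_add_le[of "p i" "sum p I" z] insert.prems
    by (simp add: sum_nonneg inf.commute)
  also have "\<dots> = 0"
    using insert by simp
  finally show ?case
    using insert by (intro order.antisym) (simp_all add: sum_nonneg add_nonneg_nonneg)
qed (auto intro: inf.absorb2)

lemma inf_scaleR_eq_0:
  fixes z e :: "'a :: banach_lattice"
  assumes "0 \<le> z" "0 \<le> e" "inf z e = 0"
  shows "inf z (real n *\<^sub>R e) = 0"
  using inf_sum_eq_0[of z "{..<n}" "\<lambda>_. e"] assms by (simp add: sum_constant_scaleR)

lemma positive_functional_mono:
  fixes f :: "'a :: banach_lattice \<Rightarrow>\<^sub>L real"
  shows "0 \<le> f \<Longrightarrow> x \<le> y \<Longrightarrow> blinfun_apply f x \<le> blinfun_apply f y"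
  unfolding less_eq_blinfun_def
  by (drule spec[of _ "y - x"]) (simp add: blinfun.bilinear_simps)

text \<open>The order ideal in question is the set of elements dominated in modulus by some \<open>e N\<close>. The
  functional \<open>G\<close> is the restriction of \<open>f\<close> to this ideal, extended by the least possible values on
  the positive cone. The hypothesis that multiples of \<open>e N\<close> are again dominated by the sequence is
  what makes \<open>G\<close> additive and homogeneous.\<close>

lemma functional_cut_to_ideal:
  fixes f :: "'a :: banach_lattice \<Rightarrow>\<^sub>L real" and e :: "nat \<Rightarrow> 'a"
  assumes f: "0 \<le> f" and e: "\<And>N. 0 \<le> e N" "incseq e"
    and dom: "\<And>N k. \<exists>M. real k *\<^sub>R e N \<le> e M"
  obtains G :: "'a \<Rightarrow>\<^sub>L real"
    where "\<And>x. 0 \<le> x \<Longrightarrow> blinfun_apply G x = (SUP N. blinfun_apply f (inf x (e N)))"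
proof -
  define R where "R x = (SUP N. f (inf x (e N)))" for x
  note mono = positive_functional_mono[OF f]
  have nonneg: "0 \<le> f (inf x (e N))" if "0 \<le> x" for x N
    using mono[of 0 "inf x (e N)"] that e by simp
  have bdd: "bdd_above (range (\<lambda>N. f (inf x (e N))))" for x
    by (rule bdd_aboveI[of _ "f x"]) (auto intro: mono)
  have upper: "f w \<le> R x" if "w \<le> x" "w \<le> e N" for w x N
    using cSUP_upper[OF UNIV_I bdd, of x N] mono[of w "inf x (e N)"] that
    unfolding R_def by simp
  have least: "R x \<le> c" if "\<And>N. f (inf x (e N)) \<le> c" for x c
    unfolding R_def by (rule cSUP_least) (use that in auto)
  have add: "R (x + y) = R x + R y" if xy: "0 \<le> x" "0 \<le> y" for x y
  proof (rule order.antisym)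
    show "R (x + y) \<le> R x + R y"
    proof (rule least)
      fix N
      have "f (inf (x + y) (e N)) \<le> f (inf x (e N)) + f (inf y (e N))"
        using mono[OF inf_add_le[OF xy e(1)]] by (simp add: blinfun.bilinear_simps)
      also have "\<dots> \<le> R x + R y"
        by (intro add_mono upper[of _ _ N]) auto
      finally show "f (inf (x + y) (e N)) \<le> R x + R y" .
    qed
    have *: "f (inf x (e N)) + f (inf y (e M)) \<le> R (x + y)" for N M
    proof -
      obtain L where L: "real 2 *\<^sub>R e (max N M) \<le> e L"
        using dom by blast
      have "inf x (e N) + inf y (e M) \<le> e (max N M) + e (max N M)"
        using incseqD[OF e(2), of N "max N M"] incseqD[OF e(2), of M "max N M"]
        by (intro add_mono le_infI2) auto
      also have "\<dots> \<le> e L"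
        using L by (simp add: scaleR_2)
      finally have "f (inf x (e N) + inf y (e M)) \<le> R (x + y)"
        by (intro upper[of _ _ L] add_mono) auto
      then show ?thesis
        by (simp add: blinfun.bilinear_simps)
    qed
    have "R x \<le> R (x + y) - f (inf y (e M))" for M
      by (rule least) (use *[of _ M] in \<open>simp add: le_diff_eq\<close>)
    then have "R y \<le> R (x + y) - R x"
      by (intro least) (simp add: le_diff_eq add.commute)
    then show "R x + R y \<le> R (x + y)"
      by simp
  qed
  have scale_le: "R (c *\<^sub>R x) \<le> c * R x" if c: "0 < c" and x: "0 \<le> x" for c x
  proof (rule least)
    fix N
    let ?w = "inf (c *\<^sub>R x) (e N)"
    obtain k where k: "inverse c \<le> real k"
      using real_arch_simple by blast
    obtain M where M: "real k *\<^sub>R e N \<le> e M"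
      using dom by blast
    have "inverse c *\<^sub>R ?w \<le> inverse c *\<^sub>R (c *\<^sub>R x)" "inverse c *\<^sub>R ?w \<le> inverse c *\<^sub>R e N"
      using c by (intro scaleR_left_mono; simp)+
    moreover have "inverse c *\<^sub>R e N \<le> e M"
      using order.trans[OF scaleR_right_mono[OF k e(1)] M] .
    ultimately have "f (inverse c *\<^sub>R ?w) \<le> R x"
      using c by (intro upper[of _ _ M]) auto
    then show "f ?w \<le> c * R x"
      using c by (simp add: blinfun.bilinear_simps field_simps)
  qed
  have R0: "R 0 = 0"
    using add[of 0 0] by simp
  have scale: "R (c *\<^sub>R x) = c * R x" if "0 \<le> c" "0 \<le> x" for c x
  proof (cases "c = 0")
    case False
    with that have c: "0 < c" by simp
    have "R (inverse c *\<^sub>R (c *\<^sub>R x)) \<le> inverse c * R (c *\<^sub>R x)"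
      using c that by (intro scale_le) (auto intro: scaleR_nonneg_nonneg)
    then have "c * R x \<le> R (c *\<^sub>R x)"
      using c by (simp add: field_simps)
    with scale_le[OF c that(2)] show ?thesis by simp
  qed (simp add: R0)
  have bound: "\<bar>R x\<bar> \<le> norm f * norm x" if "0 \<le> x" for x
  proof -
    have "0 \<le> R x"
      using upper[of 0 x 0] that e by simp
    moreover have "R x \<le> f x"
      by (rule least) (simp add: mono)
    moreover have "f x \<le> norm f * norm x"
      using norm_blinfun[of f x] by simp
    ultimately show ?thesis by simp
  qed
  obtain G :: "'a \<Rightarrow>\<^sub>L real" where "\<And>x. 0 \<le> x \<Longrightarrow> G x = R x"
    using bounded_linear_from_cone[of R, OF add scale bound norm_ge_zero] by blast
  then show ?thesis
    by (intro that[of G]) (simp add: R_def)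
qed

section \<open>Disjoint weakly null sequences\<close>

lemma pprt_disjoint:
  fixes x y :: "'a :: lattice_ab_group_add_abs"
  assumes "inf \<bar>x\<bar> \<bar>y\<bar> = 0"
  shows "inf (pprt x) (pprt y) = 0"
proof (rule order.antisym)
  have "inf (pprt x) (pprt y) \<le> inf \<bar>x\<bar> \<bar>y\<bar>"
    by (intro inf_mono pprt_le_abs)
  with assms show "inf (pprt x) (pprt y) \<le> 0" by simp
qed simp

lemma pprt_inf_pprt_minus:
  "inf (pprt x) (pprt (- x)) = (0 :: 'a :: lattice_ab_group_add)"
proof -
  have "inf (pprt x) (pprt (- x)) - pprt (- x) = inf (pprt x - pprt (- x)) 0"
    using add_inf_distrib_right[of "pprt x" "pprt (- x)" "- pprt (- x)"] by simp
  also have "\<dots> = - pprt (- x)"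
    unfolding pprt_diff_eq by (simp add: nprt_def[symmetric] pprt_neg)
  finally show ?thesis by simp
qed

text \<open>Weak convergence controls \<open>f (x n)\<close> but not \<open>f (pprt (x n))\<close>. A single functional \<open>G\<close> with
  \<open>G (x n) = f (pprt (x n))\<close> for all \<open>n\<close> removes the gap: the cut of \<open>f\<close> to the ideal generated
  by all positive parts, to which every negative part is disjoint.\<close>

lemma disjoint_weakly_null_pprt:
  fixes x :: "nat \<Rightarrow> 'a :: banach_lattice" and f :: "'a \<Rightarrow>\<^sub>L real"
  assumes disj: "disjoint_seq x" and null: "weakly_null x" and f: "0 \<le> f"
  shows "(\<lambda>n. blinfun_apply f (pprt (x n))) \<longlonglongrightarrow> 0"
proof -
  \<comment> \<open>The factor \<open>real N\<close> lets every multiple of every finite sum of positive parts lie below some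
    \<open>e N\<close>.\<close>
  define s where "s N = (\<Sum>n<N. pprt (x n))" for N
  define e where "e N = real N *\<^sub>R s N" for N
  have s: "0 \<le> s N" for N
    by (simp add: s_def sum_nonneg)
  have smono: "s N \<le> s M" if "N \<le> M" for N M
    unfolding s_def using that by (intro sum_mono2) auto
  have e0: "0 \<le> e N" for N
    using s by (simp add: e_def scaleR_nonneg_nonneg)
  have e_mono: "incseq e"
    unfolding e_def using s smono by (intro monoI scaleR_mono) auto
  have dom: "\<exists>M. real k *\<^sub>R e N \<le> e M" for N k
  proof (cases "k = 0")
    case True
    with e0 show ?thesis by auto
  next
    case False
    then have "real (k * N) *\<^sub>R s N \<le> real (k * N) *\<^sub>R s (k * N)"
      by (intro scaleR_left_mono smono) auto
    then show ?thesis
      by (intro exI[of _ "k * N"]) (simp add: e_def)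
  qed
  obtain G :: "'a \<Rightarrow>\<^sub>L real"
    where G: "\<And>y. 0 \<le> y \<Longrightarrow> G y = (SUP N. f (inf y (e N)))"
    using functional_cut_to_ideal[OF f e0 e_mono dom] by blast
  have pos: "G (pprt (x n)) = f (pprt (x n))" for n
  proof -
    have "pprt (x n) \<le> s (Suc n)"
      using s[of n] by (simp add: s_def)
    also have "\<dots> \<le> e (Suc n)"
      unfolding e_def using scaleR_right_mono[OF _ s, of 1 "real (Suc n)"] by simp
    finally have "inf (pprt (x n)) (e (Suc n)) = pprt (x n)"
      by (rule inf.absorb1)
    then have "f (pprt (x n)) \<in> range (\<lambda>N. f (inf (pprt (x n)) (e N)))"
      by (metis rangeI)
    then have "(SUP N. f (inf (pprt (x n)) (e N))) = f (pprt (x n))"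
      by (rule cSup_eq_maximum) (auto intro: positive_functional_mono[OF f])
    then show ?thesis
      by (simp add: G)
  qed
  have neg: "G (pprt (- x n)) = 0" for n
  proof -
    have "inf (pprt (- x n)) (pprt (x m)) = 0" for m
    proof (cases "m = n")
      case True
      then show ?thesis
        using pprt_inf_pprt_minus[of "x n"] by (simp add: inf.commute)
    next
      case False
      with disj show ?thesis
        by (intro pprt_disjoint) (simp add: disjoint_seq_def)
    qed
    then have "inf (pprt (- x n)) (e N) = 0" for N
      unfolding e_def using s inf_sum_eq_0[of "pprt (- x n)" "{..<N}" "\<lambda>m. pprt (x m)"]
      by (intro inf_scaleR_eq_0) (auto simp: s_def)
    then show ?thesis
      by (simp add: G)
  qed
  have "G (x n) = f (pprt (x n))" for n
    using pos[of n] neg[of n] pprt_diff_eq[of "x n"] blinfun.diff_right[of G "pprt (x n)" "pprt (- x n)"]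
    by simp
  moreover have "(\<lambda>n. G (x n)) \<longlonglongrightarrow> 0"
    using null by (simp add: weakly_null_def)
  ultimately show ?thesis
    by simp
qed

text \<open>Disjointness and weak nullity survive a change of sign, so the negative parts can be treated
  as the positive parts of \<open>- x n\<close>.\<close>

lemma disjoint_weakly_null_abs:
  fixes x :: "nat \<Rightarrow> 'a :: banach_lattice" and f :: "'a \<Rightarrow>\<^sub>L real"
  assumes "disjoint_seq x" "weakly_null x" "0 \<le> f"
  shows "(\<lambda>n. blinfun_apply f \<bar>x n\<bar>) \<longlonglongrightarrow> 0"
proof -
  have "disjoint_seq (\<lambda>n. - x n)"
    using assms(1) by (simp add: disjoint_seq_def)
  moreover have "weakly_null (\<lambda>n. - x n)"
    using assms(2) tendsto_minus[where a = "0 :: real"]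
    by (fastforce simp: weakly_null_def blinfun.bilinear_simps)
  ultimately have "(\<lambda>n. f (pprt (x n)) + f (pprt (- x n))) \<longlonglongrightarrow> 0 + 0"
    using assms by (intro tendsto_add disjoint_weakly_null_pprt)
  moreover have "\<bar>x n\<bar> = pprt (x n) + pprt (- x n)" for n
    by (simp add: abs_prts pprt_neg)
  ultimately show ?thesis
    by (simp add: blinfun.bilinear_simps)
qed

section \<open>Operators dominated by a multiple of the norm\<close>

lemma bounded_linear_dominated:
  fixes T :: "'a :: real_normed_vector \<Rightarrow> 'f :: banach_lattice"
  assumes "linear T" and u: "0 \<le> u" and dom: "\<And>x. \<bar>T x\<bar> \<le> norm x *\<^sub>R u"
  shows "bounded_linear T"
proof (rule bounded_linear_intro)
  fix x y c
  show "T (x + y) = T x + T y" "T (c *\<^sub>R x) = c *\<^sub>R T x"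
    using assms(1) by (simp_all add: linear_add linear_scale)
  have "norm (T x) \<le> norm (norm x *\<^sub>R u)"
    using dom[of x] u by (intro norm_mono_abs) (simp add: scaleR_nonneg_nonneg)
  then show "norm (T x) \<le> norm x * norm u"
    by simp
qed

lemma apply_dual_map:
  "bounded_linear T \<Longrightarrow> blinfun_apply (dual_map T \<phi>) x = blinfun_apply \<phi> (T x)"
  unfolding dual_map_def
  by (subst bounded_linear_Blinfun_apply)
    (auto intro: bounded_linear_compose[OF blinfun.bounded_linear_right])

lemma bounded_linear_dual_map:
  assumes T: "bounded_linear T"
  shows "bounded_linear (dual_map T)"
proof -
  have "dual_map T = (\<lambda>\<phi>. \<phi> o\<^sub>L Blinfun T)"
    by (intro ext blinfun_eqI) (simp add: apply_dual_map[OF T] bounded_linear_Blinfun_apply[OF T])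
  then show ?thesis
    by (simp add: bounded_bilinear.bounded_linear_left[OF bounded_bilinear_blinfun_compose])
qed

lemma norm_dual_map_dominated:
  fixes T :: "'a :: real_normed_vector \<Rightarrow> 'f :: banach_lattice" and \<phi> :: "'f \<Rightarrow>\<^sub>L real"
  assumes "linear T" "0 \<le> u" and dom: "\<And>x. \<bar>T x\<bar> \<le> norm x *\<^sub>R u"
  shows "norm (dual_map T \<phi>) \<le> blinfun_apply \<bar>\<phi>\<bar> u"
proof (rule norm_blinfun_bound)
  note mono = positive_functional_mono[OF abs_ge_zero[of \<phi>]]
  show "0 \<le> \<bar>\<phi>\<bar> u"
    using mono[OF assms(2)] by simp
  fix x
  have "\<bar>\<phi> (T x)\<bar> \<le> \<bar>\<phi>\<bar> \<bar>T x\<bar>"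
    by (rule abs_apply_le_blinfun)
  also have "\<dots> \<le> \<bar>\<phi>\<bar> (norm x *\<^sub>R u)"
    by (rule mono[OF dom])
  finally show "norm (dual_map T \<phi> x) \<le> \<bar>\<phi>\<bar> u * norm x"
    using apply_dual_map[OF bounded_linear_dominated[OF assms]]
    by (simp add: blinfun.bilinear_simps mult.commute)
qed

lemma order_bounded_imp_dominated:
  fixes T :: "('k :: topological_space \<Rightarrow>\<^sub>C real) \<Rightarrow> 'f :: banach_lattice"
  assumes "linear T" "order_bounded T"
  obtains u where "0 \<le> u" "\<And>f. \<bar>T f\<bar> \<le> norm f *\<^sub>R u"
proof -
  define one :: "'k \<Rightarrow>\<^sub>C real" where "one = const_bcontfun 1"
  have "order_bounded_set (T ` {- one..one})"
    using assms(2) unfolding order_bounded_def order_bounded_set_def by blast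
  then obtain a b where ab: "T ` {- one..one} \<subseteq> {a..b}"
    unfolding order_bounded_set_def by blast
  have ball: "T f \<le> \<bar>b\<bar>" if "norm f \<le> 1" for f
  proof -
    have "\<bar>f x\<bar> \<le> 1" for x
      using norm_bounded[of f x] that by simp
    then have "f \<in> {- one..one}"
      by (auto simp: one_def less_eq_bcontfun_def const_bcontfun.rep_eq abs_le_iff minus_le_iff)
    with ab have "T f \<in> {a..b}" by blast
    then have "T f \<le> b" by simp
    then show ?thesis using abs_ge_self order.trans by blast
  qed
  \<comment> \<open>The ball is symmetric, so the upper bound alone also controls the modulus.\<close>
  have "\<bar>T f\<bar> \<le> norm f *\<^sub>R \<bar>b\<bar>" for f
  proof (cases "f = 0")
    case True
    then show ?thesis by (simp add: linear_0[OF assms(1)])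
  next
    case False
    have *: "T g \<le> norm f *\<^sub>R \<bar>b\<bar>" if "norm g = norm f" for g
    proof -
      have "T (inverse (norm f) *\<^sub>R g) \<le> \<bar>b\<bar>"
        using False that by (intro ball) simp
      from scaleR_left_mono[OF this norm_ge_zero[of f]] show ?thesis
        using False by (simp add: linear_scale[OF assms(1)])
    qed
    show ?thesis
      using *[of f] *[of "- f"] by (intro abs_leI) (simp_all add: linear_neg[OF assms(1)])
  qed
  then show ?thesis
    using that[of "\<bar>b\<bar>"] by simp
qed

theorem proposition4p1:
  fixes T :: "('k :: t2_space \<Rightarrow>\<^sub>C real) \<Rightarrow> 'f :: banach_lattice"
  assumes "compact (UNIV :: 'k set)"
    and "linear T"
    and "order_bounded T"
  shows "positively_limited T \<and> almost_Dunford_Pettis (dual_map T)"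
proof -
  obtain u where u: "0 \<le> u" and dom: "\<And>f. \<bar>T f\<bar> \<le> norm f *\<^sub>R u"
    using order_bounded_imp_dominated[OF assms(2,3)] by blast
  have T: "bounded_linear T"
    by (rule bounded_linear_dominated[OF assms(2) u dom])
  note le = norm_dual_map_dominated[OF assms(2) u dom]
  have null: "(\<lambda>n. dual_map T (\<phi> n)) \<longlonglongrightarrow> 0"
    if "(\<lambda>n. blinfun_apply \<bar>\<phi> n\<bar> u) \<longlonglongrightarrow> 0" for \<phi> :: "nat \<Rightarrow> 'f \<Rightarrow>\<^sub>L real"
    by (rule Lim_null_comparison[OF always_eventually that]) (use le in blast)
  have "positively_limited T"
    unfolding positively_limited_def
  proof (intro conjI allI impI T)
    fix \<phi> :: "nat \<Rightarrow> 'f \<Rightarrow>\<^sub>L real"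
    assume "(\<forall>n. 0 \<le> \<phi> n) \<and> weak_star_null \<phi>"
    then show "(\<lambda>n. dual_map T (\<phi> n)) \<longlonglongrightarrow> 0"
      by (intro null) (simp add: weak_star_null_def)
  qed
  moreover have "almost_Dunford_Pettis (dual_map T)"
    unfolding almost_Dunford_Pettis_def
  proof (intro conjI allI impI bounded_linear_dual_map T)
    fix \<phi> :: "nat \<Rightarrow> 'f \<Rightarrow>\<^sub>L real"
    assume \<phi>: "disjoint_seq \<phi> \<and> weakly_null \<phi>"
    define ev :: "('f \<Rightarrow>\<^sub>L real) \<Rightarrow>\<^sub>L real" where "ev = Blinfun (\<lambda>\<psi>. blinfun_apply \<psi> u)"
    have ev: "ev \<psi> = \<psi> u" for \<psi>
      by (simp add: ev_def bounded_linear_Blinfun_apply blinfun.bounded_linear_left)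
    have "0 \<le> ev"
      unfolding less_eq_blinfun_def[of 0 ev] using positive_functional_mono[OF _ u] by (fastforce simp: ev)
    then have "(\<lambda>n. ev \<bar>\<phi> n\<bar>) \<longlonglongrightarrow> 0"
      using \<phi> by (intro disjoint_weakly_null_abs) auto
    then show "(\<lambda>n. dual_map T (\<phi> n)) \<longlonglongrightarrow> 0"
      by (intro null) (simp add: ev)
  qed
  ultimately show ?thesis ..
qed

end
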